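(* Let $n\ge2$ and let $A=B+iC\in\mathcal H_n$ (so $B,C\in\mathbb R^{n\times n}$ are symmetric positive definite). Put $$\delta_A=\left\|(B+C)^{-1/2}(C-B)(B+C)^{-1/2}\right\|,$$ where $\|\cdot\|$ is the spectral norm. Then $$\rho_n(A)\le 1+\delta_A^2<2.$$
   Context: $\mathcal H_n$ (Higham matrices of order $n$) is the set of complex matrices $P+iQ$ with $P,Q\in\mathbb R^{n\times n}$ symmetric positive definite. For $A=(a_{ij})\in\mathbb C^{n\times n}$ and $1\le k\le n-1$, $A^{(k)}=(a^{(k)}_{ij})\in\mathbb C^{(n-k)\times(n-k)}$ is the active matrix remaining after $k$ steps of Gaussian elimination without pivoting, i.e. the Schur complement $A_{22}-A_{21}A_{11}^{-1}A_{12}$ of the leading $k\times k$ principal block $A_{11}$ of $A$ (leading principal submatrices of matrices in $\mathcal H_n$ are nonsingular). The growth factor is $$\rho_n(A)=\frac{\max_{1\le k\le n-1}\max_{i,j}|a_{ij}^{(k)}|}{\max_{i,j}|a_{ij}|}.$$ *)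

theory Defs
  imports Complex_Main "Jordan_Normal_Form.Gauss_Jordan_Elimination"
begin

definition spd_mat :: "nat \<Rightarrow> real mat \<Rightarrow> bool" where
  "spd_mat n M \<longleftrightarrow> M \<in> carrier_mat n n \<and> transpose_mat M = M \<and>
     (\<forall>x \<in> carrier_vec n. x \<noteq> 0\<^sub>v n \<longrightarrow> x \<bullet> (M *\<^sub>v x) > 0)"

definition complex_mat :: "real mat \<Rightarrow> real mat \<Rightarrow> complex mat" where
  "complex_mat P Q = map_mat complex_of_real P + \<i> \<cdot>\<^sub>m map_mat complex_of_real Q"

definition higham_mats :: "nat \<Rightarrow> complex mat set" where
  "higham_mats n = {complex_mat P Q | P Q. spd_mat n P \<and> spd_mat n Q}"

(* Meaningful only for invertible M. *)
definition mat_inv :: "'a :: field mat \<Rightarrow> 'a mat" where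
  "mat_inv M = the (mat_inverse M)"

(* The matrix A^(k), as the Schur complement of the leading k x k block. Its
   rows and columns are renumbered from 0. *)
definition active_mat :: "'a :: field mat \<Rightarrow> nat \<Rightarrow> 'a mat" where
  "active_mat A k =
     (case split_block A k k of (A11, A12, A21, A22) \<Rightarrow> A22 - A21 * mat_inv A11 * A12)"

definition max_entry :: "complex mat \<Rightarrow> real" where
  "max_entry A = Max {cmod (A $$ (i, j)) | i j. i < dim_row A \<and> j < dim_col A}"

(* Meaningful only for square A of order at least 2; otherwise the outer maximum
   is over the empty set. *)
definition growth_factor :: "complex mat \<Rightarrow> real" where
  "growth_factor A =
     Max ((\<lambda>k. max_entry (active_mat A k)) ` {1..dim_row A - 1}) / max_entry A"

(* The positive definite square root. Meaningful only for symmetric positive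
   definite M, where it exists and is unique. *)
definition spd_sqrt :: "real mat \<Rightarrow> real mat" where
  "spd_sqrt M = (THE S. spd_mat (dim_row M) S \<and> S * S = M)"

definition mat_inv_sqrt :: "real mat \<Rightarrow> real mat" where
  "mat_inv_sqrt M = mat_inv (spd_sqrt M)"

definition vec_l2_norm :: "real vec \<Rightarrow> real" where
  "vec_l2_norm x = sqrt (x \<bullet> x)"

(* Operator norm induced by the Euclidean norm; meaningful only for matrices with
   at least one column. *)
definition spectral_norm :: "real mat \<Rightarrow> real" where
  "spectral_norm M =
     (SUP x \<in> {x \<in> carrier_vec (dim_col M). vec_l2_norm x = 1}. vec_l2_norm (M *\<^sub>v x))"

definition higham_delta :: "real mat \<Rightarrow> real mat \<Rightarrow> real" where
  "higham_delta B C = spectral_norm (mat_inv_sqrt (B + C) * (C - B) * mat_inv_sqrt (B + C))"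

end

theory Submission
  imports Defs "Jordan_Normal_Form.Spectral_Radius"
begin

text \<open>
  Put \<open>M = B + C\<close>, \<open>D = C - B\<close> and \<open>W = M + iD\<close>. Since \<open>W = (1 - i) A\<close>, elimination on \<open>W\<close>
  produces the active matrices of \<open>A\<close> times \<open>1 - i\<close>. With \<open>S\<close> the square root of \<open>M\<close> and
  \<open>K = S\<^sup>-\<^sup>1 D S\<^sup>-\<^sup>1\<close> one has \<open>W = S (1 + iK) S\<close>, where \<open>K\<close> is symmetric with norm
  \<open>\<delta> = higham_delta B C\<close> (lemma \<open>higham_delta_factorization\<close>).

  Column \<open>j\<close> of the Schur complement of \<open>W\<close> consists of the lower entries of \<open>W x\<close>, where \<open>x\<close>
  has lower part \<open>e\<^sub>j\<close> and its upper part is chosen such that the upper entries of \<open>W x\<close> vanish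
  (lemma \<open>active_mat_as_image\<close>). Let \<open>s\<close> be the diagonal entry of this column; then
  \<open>x\<^sup>* W x = s\<close>, and the real part of it is \<open>|S x|\<^sup>2\<close>. On the other hand the entry of \<open>W x\<close>
  with index \<open>i\<close> is the product of \<open>S e\<^sub>i\<close> with \<open>(1 + iK) S x\<close>, so by the Cauchy-Schwarz
  inequality its squared modulus is at most
  \<open>M\<^sub>i\<^sub>i (1 + \<delta>\<^sup>2) |S x|\<^sup>2 \<le> M\<^sub>i\<^sub>i (1 + \<delta>\<^sup>2) |s|\<close> (lemma \<open>accretive_entry_bound\<close>).

  For the diagonal entry itself this reads \<open>|s|\<^sup>2 \<le> M\<^sub>j\<^sub>j (1 + \<delta>\<^sup>2) |s|\<close>, that is,
  \<open>|s| \<le> (1 + \<delta>\<^sup>2) M\<^sub>j\<^sub>j\<close>. Inserting this bound again gives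
  \<open>|(W x)\<^sub>i|\<^sup>2 \<le> (1 + \<delta>\<^sup>2)\<^sup>2 M\<^sub>i\<^sub>i M\<^sub>j\<^sub>j\<close> for all entries (lemma \<open>active_mat_entry_bound\<close>).
  Finally \<open>M\<^sub>i\<^sub>i = b\<^sub>i\<^sub>i + c\<^sub>i\<^sub>i\<close> is at most \<open>sqrt 2\<close> times \<open>|a\<^sub>i\<^sub>i|\<close>, and \<open>sqrt 2\<close> is the modulus of
  \<open>1 - i\<close>.

  That \<open>\<delta> < 1\<close> comes from \<open>M + D = 2C\<close> and \<open>M - D = 2B\<close> being positive definite. It needs the
  spectral theorem for real symmetric matrices (lemma \<open>symmetric_mat_spectral\<close>), which also
  supplies the square root of \<open>M\<close>.
\<close>

section \<open>Real vectors and complex matrices\<close>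

lemma symmetric_mat_scalar_prod:
  fixes A :: "real mat"
  assumes "A \<in> carrier_mat n n" "transpose_mat A = A" "x \<in> carrier_vec n" "y \<in> carrier_vec n"
  shows "(A *\<^sub>v x) \<bullet> y = x \<bullet> (A *\<^sub>v y)"
  using transpose_vec_mult_scalar[of A n n y x] assms by simp

lemma scalar_prod_self_nonneg: "0 \<le> (x :: real vec) \<bullet> x"
  by (auto simp: scalar_prod_def intro: sum_nonneg)

lemma nonzero_vec_entry:
  assumes "x \<in> carrier_vec n" "x \<noteq> 0\<^sub>v n"
  obtains i where "i < n" "x $ i \<noteq> 0"
  using assms by (metis eq_vecI carrier_vecD index_zero_vec)

lemma mult_mat_zero_vec:
  fixes A :: "'a :: semiring_0 mat"
  assumes "A \<in> carrier_mat n m"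
  shows "A *\<^sub>v 0\<^sub>v m = 0\<^sub>v n"
  using assms by (intro eq_vecI) auto

lemma scalar_prod_self_pos:
  fixes x :: "real vec"
  assumes "x \<in> carrier_vec n" "x \<noteq> 0\<^sub>v n"
  shows "x \<bullet> x > 0"
proof -
  obtain i where i: "i < n" "x $ i \<noteq> 0" using nonzero_vec_entry[OF assms] .
  have "0 < x $ i * x $ i" using i by (simp add: zero_less_mult_iff) linarith
  also have "\<dots> \<le> x \<bullet> x" unfolding scalar_prod_def
    using i assms by (intro member_le_sum) auto
  finally show ?thesis .
qed

lemma scalar_prod_Cauchy_Schwarz:
  fixes x y :: "real vec"
  assumes "x \<in> carrier_vec n" "y \<in> carrier_vec n"
  shows "(x \<bullet> y)\<^sup>2 \<le> (x \<bullet> x) * (y \<bullet> y)"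
proof (cases "y = 0\<^sub>v n")
  case True
  thus ?thesis using assms by simp
next
  case False
  hence pos: "y \<bullet> y > 0" using scalar_prod_self_pos assms(2) by blast
  define z where "z = (y \<bullet> y) \<cdot>\<^sub>v x - (x \<bullet> y) \<cdot>\<^sub>v y"
  have "z \<bullet> z = (y \<bullet> y) * ((x \<bullet> x) * (y \<bullet> y) - (x \<bullet> y)\<^sup>2)"
    unfolding z_def using assms comm_scalar_prod[OF assms]
    by (simp add: minus_scalar_prod_distrib[of _ n] scalar_prod_minus_distrib[of _ n]
        power2_eq_square algebra_simps)
  hence "0 \<le> (y \<bullet> y) * ((x \<bullet> x) * (y \<bullet> y) - (x \<bullet> y)\<^sup>2)"
    using scalar_prod_self_nonneg[of z] by simp
  thus ?thesis using pos by (simp add: zero_le_mult_iff)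
qed

lemma mult_unit_vec_index:
  fixes A :: "real mat"
  assumes "A \<in> carrier_mat n m" "i < n" "j < m"
  shows "(A *\<^sub>v unit_vec m j) $ i = A $$ (i, j)"
  using assms by simp

lemma complex_mat_carrier [simp]:
  assumes "P \<in> carrier_mat n m" "Q \<in> carrier_mat n m"
  shows "complex_mat P Q \<in> carrier_mat n m"
  using assms by (auto simp: complex_mat_def)

lemma complex_mat_index:
  assumes "P \<in> carrier_mat n m" "Q \<in> carrier_mat n m" "i < n" "j < m"
  shows "complex_mat P Q $$ (i, j) = Complex (P $$ (i, j)) (Q $$ (i, j))"
  using assms by (auto simp: complex_mat_def complex_eq_iff)

lemma complex_mat_mult_vec:
  assumes "P \<in> carrier_mat n m" "Q \<in> carrier_mat n m" "x \<in> carrier_vec m"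
  shows "map_vec Re (complex_mat P Q *\<^sub>v x) = P *\<^sub>v map_vec Re x - Q *\<^sub>v map_vec Im x"
    and "map_vec Im (complex_mat P Q *\<^sub>v x) = P *\<^sub>v map_vec Im x + Q *\<^sub>v map_vec Re x"
proof -
  have c: "complex_mat P Q \<in> carrier_mat n m" using assms by simp
  have *: "(complex_mat P Q *\<^sub>v x) $ i = (\<Sum>j<m. Complex (P $$ (i, j)) (Q $$ (i, j)) * x $ j)"
    if "i < n" for i
    using that assms(3) c complex_mat_index[OF assms(1,2) that]
    by (auto simp: scalar_prod_def atLeast0LessThan carrier_matD[OF c] intro!: sum.cong)
  have re: "(P *\<^sub>v map_vec f x) $ i = (\<Sum>j<m. P $$ (i, j) * f (x $ j))" 
    if "i < n" "P \<in> carrier_mat n m" for i f and P :: "real mat"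
    using that assms(3) by (auto simp: scalar_prod_def atLeast0LessThan intro!: sum.cong)
  show "map_vec Re (complex_mat P Q *\<^sub>v x) = P *\<^sub>v map_vec Re x - Q *\<^sub>v map_vec Im x"
  proof (rule eq_vecI)
    fix i assume "i < dim_vec (P *\<^sub>v map_vec Re x - Q *\<^sub>v map_vec Im x)"
    hence i: "i < n" using assms by auto
    show "map_vec Re (complex_mat P Q *\<^sub>v x) $ i = (P *\<^sub>v map_vec Re x - Q *\<^sub>v map_vec Im x) $ i"
      using i assms by (simp add: carrier_matD[OF c] * re sum_subtractf del: index_mult_mat_vec)
  qed (use assms in \<open>simp_all add: carrier_matD[OF c]\<close>)
  show "map_vec Im (complex_mat P Q *\<^sub>v x) = P *\<^sub>v map_vec Im x + Q *\<^sub>v map_vec Re x"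
  proof (rule eq_vecI)
    fix i assume "i < dim_vec (P *\<^sub>v map_vec Im x + Q *\<^sub>v map_vec Re x)"
    hence i: "i < n" using assms by auto
    show "map_vec Im (complex_mat P Q *\<^sub>v x) $ i = (P *\<^sub>v map_vec Im x + Q *\<^sub>v map_vec Re x) $ i"
      using i assms by (simp add: carrier_matD[OF c] * re sum.distrib del: index_mult_mat_vec)
  qed (use assms in \<open>simp_all add: carrier_matD[OF c]\<close>)
qed

section \<open>The spectral theorem for real symmetric matrices\<close>

text \<open>
  The characteristic polynomial has a root over the complex numbers. Comparing \<open>Aa \<bullet> b\<close> with
  \<open>a \<bullet> Ab\<close> for the real and imaginary parts \<open>a\<close>, \<open>b\<close> of a complex eigenvector shows that the
  eigenvalue is real; then \<open>a\<close> and \<open>b\<close> both lie in its eigenspace, and one of them is nonzero.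
\<close>
lemma symmetric_mat_unit_eigenvector:
  fixes A :: "real mat"
  assumes A: "A \<in> carrier_mat n n" "transpose_mat A = A" and n: "n > 0"
  obtains v l where "v \<in> carrier_vec n" "v \<bullet> v = 1" "A *\<^sub>v v = l \<cdot>\<^sub>v v"
proof -
  \<comment> \<open>The complexification of \<open>A\<close>, where eigenvectors exist.\<close>
  define Z where "Z = complex_mat A (0\<^sub>m n n)"
  have Z: "Z \<in> carrier_mat n n" using A by (simp add: Z_def)
  from spectrum_non_empty[OF Z n] obtain mu w where "eigenvector Z w mu"
    by (auto simp: spectrum_def eigenvalue_def)
  hence w: "w \<in> carrier_vec n" "w \<noteq> 0\<^sub>v n" "Z *\<^sub>v w = mu \<cdot>\<^sub>v w"
    using Z by (auto simp: eigenvector_def)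
  define a b where "a = map_vec Re w" and "b = map_vec Im w"
  have ab: "a \<in> carrier_vec n" "b \<in> carrier_vec n" using w by (auto simp: a_def b_def)
  have z: "0\<^sub>m n n *\<^sub>v u = 0\<^sub>v n" if "u \<in> carrier_vec n" for u :: "real vec"
    using that by (intro eq_vecI) auto
  have Aa: "A *\<^sub>v a = Re mu \<cdot>\<^sub>v a - Im mu \<cdot>\<^sub>v b"
  proof -
    have "A *\<^sub>v a = A *\<^sub>v a - 0\<^sub>m n n *\<^sub>v b" using z[OF ab(2)] A ab by (intro eq_vecI) auto
    also have "\<dots> = map_vec Re (mu \<cdot>\<^sub>v w)"
      using complex_mat_mult_vec(1)[OF A(1) zero_carrier_mat w(1)] w(3) by (simp add: a_def b_def Z_def)
    also have "\<dots> = Re mu \<cdot>\<^sub>v a - Im mu \<cdot>\<^sub>v b" using w by (intro eq_vecI) (auto simp: a_def b_def)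
    finally show ?thesis .
  qed
  have Ab: "A *\<^sub>v b = Re mu \<cdot>\<^sub>v b + Im mu \<cdot>\<^sub>v a"
  proof -
    have "A *\<^sub>v b = A *\<^sub>v b + 0\<^sub>m n n *\<^sub>v a" using z[OF ab(1)] A ab by (intro eq_vecI) auto
    also have "\<dots> = map_vec Im (mu \<cdot>\<^sub>v w)"
      using complex_mat_mult_vec(2)[OF A(1) zero_carrier_mat w(1)] w(3) by (simp add: a_def b_def Z_def)
    also have "\<dots> = Re mu \<cdot>\<^sub>v b + Im mu \<cdot>\<^sub>v a" using w by (intro eq_vecI) (auto simp: a_def b_def)
    finally show ?thesis .
  qed
  have nz: "a \<bullet> a > 0 \<or> b \<bullet> b > 0"
  proof (rule ccontr)
    assume "\<not> ?thesis"
    hence "a = 0\<^sub>v n" "b = 0\<^sub>v n" using scalar_prod_self_pos ab by blast+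
    hence "a $ i = 0" "b $ i = 0" if "i < n" for i
      using that by simp_all
    hence "w $ i = 0" if "i < n" for i
      using that w(1) by (simp add: a_def b_def complex_eq_iff)
    hence "w = 0\<^sub>v n" using w(1) by (intro eq_vecI) auto
    with w show False by simp
  qed
  have "(A *\<^sub>v a) \<bullet> b = a \<bullet> (A *\<^sub>v b)" using symmetric_mat_scalar_prod A ab by blast
  hence "Im mu * (a \<bullet> a + b \<bullet> b) = 0"
    unfolding Aa Ab using ab comm_scalar_prod[OF ab]
    by (simp add: minus_scalar_prod_distrib[of _ n] scalar_prod_add_distrib[of _ n] algebra_simps)
  hence "Im mu = 0" using nz scalar_prod_self_nonneg[of a] scalar_prod_self_nonneg[of b]
    by (auto simp: add_nonneg_eq_0_iff)
  hence ev: "A *\<^sub>v a = Re mu \<cdot>\<^sub>v a" "A *\<^sub>v b = Re mu \<cdot>\<^sub>v b"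
    using Aa Ab ab by auto
  obtain u where u: "u \<in> carrier_vec n" "u \<bullet> u > 0" "A *\<^sub>v u = Re mu \<cdot>\<^sub>v u"
    using nz ev ab by blast
  define v where "v = (1 / sqrt (u \<bullet> u)) \<cdot>\<^sub>v u"
  have "v \<in> carrier_vec n" using u by (simp add: v_def)
  moreover have "v \<bullet> v = 1" using u by (simp add: v_def)
  moreover have "A *\<^sub>v v = Re mu \<cdot>\<^sub>v v"
    using u A by (simp add: v_def mult_mat_vec[OF A(1) u(1)] smult_smult_assoc mult.commute)
  ultimately show ?thesis using that by blast
qed

text \<open>
  The reflection along \<open>w = e\<^sub>0 - v\<close> swaps \<open>e\<^sub>0\<close> and \<open>v\<close>. It completes \<open>v\<close> to an orthonormal basis
  without a Gram-Schmidt process (for \<open>w = 0\<close> the identity does). It is its own inverse and its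
  own transpose, so conjugating by it preserves symmetry.
\<close>
lemma householder:
  fixes v :: "real vec"
  assumes v: "v \<in> carrier_vec n" "v \<bullet> v = 1" and n: "0 < n"
  obtains H where "H \<in> carrier_mat n n" "transpose_mat H = H" "H * H = 1\<^sub>m n"
    "H *\<^sub>v unit_vec n 0 = v"
proof (cases "v = unit_vec n 0")
  case True
  thus ?thesis using that[of "1\<^sub>m n"] by simp
next
  case False
  define w where "w = unit_vec n 0 - v"
  have w: "w \<in> carrier_vec n" using v by (simp add: w_def)
  have "w \<noteq> 0\<^sub>v n"
  proof
    assume 0: "w = 0\<^sub>v n"
    have "v $ i = unit_vec n 0 $ i" if "i < n" for i
      using that v arg_cong[OF 0, of "\<lambda>u. u $ i"] by (simp add: w_def)
    hence "v = unit_vec n 0" using v by (intro eq_vecI) auto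
    with False show False by simp
  qed
  hence pos: "w \<bullet> w > 0" using scalar_prod_self_pos w by blast
  have ww: "w \<bullet> w = 2 * w $ 0" 
    using v n by (simp add: w_def minus_scalar_prod_distrib[of _ n] scalar_prod_minus_distrib[of _ n])
  define c where "c = 2 / (w \<bullet> w)"
  define H where "H = mat n n (\<lambda>(i, j). (if i = j then 1 else 0) - c * w $ i * w $ j)"
  have H: "H \<in> carrier_mat n n" by (simp add: H_def)
  moreover have "transpose_mat H = H" by (rule eq_matI) (auto simp: H_def)
  moreover have "H * H = 1\<^sub>m n"
  proof (rule eq_matI)
    fix i j assume "i < dim_row (1\<^sub>m n :: real mat)" "j < dim_col (1\<^sub>m n :: real mat)"
    hence ij: "i < n" "j < n" by auto
    have "(H * H) $$ (i, j) = (\<Sum>k<n. ((if i = k then 1 else 0) - c * w $ i * w $ k) *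
            ((if k = j then 1 else 0) - c * w $ k * w $ j))"
      using ij by (auto simp: H_def scalar_prod_def atLeast0LessThan)
    also have "\<dots> = (\<Sum>k<n. (if k = i then (if i = j then 1 else 0) - c * w $ i * w $ j else 0)
            - (if k = j then c * w $ i * w $ j else 0) + c * c * w $ i * w $ j * (w $ k * w $ k))"
      by (intro sum.cong) (auto simp: algebra_simps)
    also have "\<dots> = (if i = j then 1 else 0) - 2 * c * w $ i * w $ j 
        + c * c * w $ i * w $ j * (w \<bullet> w)"
      using ij w by (simp add: sum.distrib sum_subtractf sum_distrib_left[symmetric]
          scalar_prod_def atLeast0LessThan)
    also have "\<dots> = (if i = j then 1 else 0)" using pos by (simp add: c_def)
    finally show "(H * H) $$ (i, j) = 1\<^sub>m n $$ (i, j)" using ij by simp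
  qed (auto simp: H_def)
  moreover have "H *\<^sub>v unit_vec n 0 = v"
  proof (rule eq_vecI)
    fix i assume "i < dim_vec v"
    hence i: "i < n" using v by simp
    have "(H *\<^sub>v unit_vec n 0) $ i = (if i = 0 then 1 else 0) - c * w $ i * w $ 0"
      using i n by (simp add: H_def)
    also have "\<dots> = (if i = 0 then 1 else 0) - w $ i" using pos ww by (simp add: c_def)
    also have "\<dots> = v $ i" using i v by (simp add: w_def)
    finally show "(H *\<^sub>v unit_vec n 0) $ i = v $ i" .
  qed (use v H in auto)
  ultimately show ?thesis using that by blast
qed

lemma symmetric_mat_congruence:
  fixes A U :: "real mat"
  assumes "A \<in> carrier_mat n n" "transpose_mat A = A" "U \<in> carrier_mat n n"
  shows "transpose_mat (transpose_mat U * A * U) = transpose_mat U * A * U"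
proof -
  have U: "transpose_mat U \<in> carrier_mat n n" using assms(3) by simp
  have "transpose_mat (transpose_mat U * A * U) = transpose_mat U * (A * U)"
    using transpose_mult[OF mult_carrier_mat[OF U assms(1)] assms(3)] transpose_mult[OF U assms(1)] assms(2)
    by simp
  thus ?thesis using assoc_mult_mat[OF U assms(1,3)] by simp
qed

text \<open>
  Deflation: conjugating by the reflection that sends \<open>e\<^sub>0\<close> to a unit eigenvector makes the first
  column a multiple of \<open>e\<^sub>0\<close>, by symmetry also the first row, and leaves a symmetric block of one
  order less.
\<close>
theorem symmetric_mat_spectral:
  fixes A :: "real mat"
  assumes "A \<in> carrier_mat n n" "transpose_mat A = A"
  shows "\<exists>U f. U \<in> carrier_mat n n \<and> transpose_mat U * U = 1\<^sub>m n \<and> U * transpose_mat U = 1\<^sub>m n \<and>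
    A = U * mat_diag n f * transpose_mat U"
  using assms
proof (induction n arbitrary: A)
  case 0
  show ?case by (rule exI[of _ "1\<^sub>m 0"], rule exI[of _ "\<lambda>_. 0"]) (use 0 in \<open>auto intro!: eq_matI\<close>)
next
  case (Suc n)
  let ?N = "Suc n"
  note A = Suc.prems
  obtain v l where v: "v \<in> carrier_vec ?N" "v \<bullet> v = 1" "A *\<^sub>v v = l \<cdot>\<^sub>v v"
    using symmetric_mat_unit_eigenvector[OF A] by blast
  obtain H where H: "H \<in> carrier_mat ?N ?N" "transpose_mat H = H" "H * H = 1\<^sub>m ?N"
    "H *\<^sub>v unit_vec ?N 0 = v"
    using householder[OF v(1,2)] by blast
  define A' where "A' = H * A * H"
  have A': "A' \<in> carrier_mat ?N ?N" using A H by (simp add: A'_def)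
  have A'sym: "transpose_mat A' = A'"
    using symmetric_mat_congruence[OF A H(1)] H(2) by (simp add: A'_def)
  have e: "unit_vec ?N 0 \<in> carrier_vec ?N" by simp
  have Hv: "H *\<^sub>v v = unit_vec ?N 0"
    using assoc_mult_mat_vec[OF H(1) H(1) e] H(3,4) by simp
  have "A' *\<^sub>v unit_vec ?N 0 = l \<cdot>\<^sub>v unit_vec ?N 0"
    using assoc_mult_mat_vec[OF mult_carrier_mat[OF H(1) A(1)] H(1) e]
      assoc_mult_mat_vec[OF H(1) A(1) v(1)] mult_mat_vec[OF H(1) v(1)] H(4) Hv v(3)
    by (simp only: A'_def)
  hence col0: "A' $$ (i, 0) = (if i = 0 then l else 0)" if "i < ?N" for i
    using that mult_unit_vec_index[OF A' that, of 0] by auto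
  have row0: "A' $$ (0, i) = (if i = 0 then l else 0)" if "i < ?N" for i
    using col0[OF that] arg_cong[OF A'sym, of "\<lambda>X. X $$ (0, i)"] that A' by auto
  define A3 where "A3 = mat n n (\<lambda>(i, j). A' $$ (Suc i, Suc j))"
  have A3: "A3 \<in> carrier_mat n n" by (simp add: A3_def)
  have "transpose_mat A3 = A3"
  proof (rule eq_matI)
    fix i j assume "i < dim_row A3" "j < dim_col A3"
    hence "i < n" "j < n" by (auto simp: A3_def)
    thus "transpose_mat A3 $$ (i, j) = A3 $$ (i, j)"
      using arg_cong[OF A'sym, of "\<lambda>X. X $$ (Suc i, Suc j)"] A' by (simp add: A3_def)
  qed (auto simp: A3_def)
  from Suc.IH[OF A3 this] obtain V g where V: "V \<in> carrier_mat n n" 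
    "transpose_mat V * V = 1\<^sub>m n" "V * transpose_mat V = 1\<^sub>m n"
    "A3 = V * mat_diag n g * transpose_mat V" by blast
  \<comment> \<open>The block diagonal embeddings of order \<open>n\<close> into order \<open>n + 1\<close> respect products, transposes,
    identity and diagonal matrices, so the diagonalization of the smaller block lifts.\<close>
  define blk where "blk = (\<lambda>a X. four_block_mat (mat 1 1 (\<lambda>_. a)) (0\<^sub>m 1 n) (0\<^sub>m n 1) X :: real mat)"
  have blk: "blk a X \<in> carrier_mat ?N ?N" if "X \<in> carrier_mat n n" for a X
    using that by (auto simp: blk_def)
  have blk_mult: "blk a X * blk b Y = blk (a * b) (X * Y)"
    if "X \<in> carrier_mat n n" "Y \<in> carrier_mat n n" for a b X Y
  proof -
    have "mat 1 1 (\<lambda>_. a) * mat 1 1 (\<lambda>_. b) = mat 1 1 (\<lambda>_. a * b)"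
      by (rule eq_matI) (auto simp: scalar_prod_def)
    thus ?thesis using that unfolding blk_def
      by (subst mult_four_block_mat[of _ 1 1 _ n _ n _ _ 1 _ n]) auto
  qed
  have blk_transpose: "transpose_mat (blk a X) = blk a (transpose_mat X)"
    if "X \<in> carrier_mat n n" for a X
    using that unfolding blk_def
    by (subst transpose_four_block_mat[of _ 1 1 _ n _ n]) (auto intro!: arg_cong[of _ _ "\<lambda>Z. four_block_mat Z _ _ _"])
  have blk_one: "blk 1 (1\<^sub>m n) = 1\<^sub>m ?N"
    by (rule eq_matI) (auto simp: blk_def)
  define f where "f = (\<lambda>i. case i of 0 \<Rightarrow> l | Suc i \<Rightarrow> g i)"
  have blk_diag: "blk l (mat_diag n g) = mat_diag ?N f"
    by (rule eq_matI) (auto simp: blk_def f_def mat_diag_def split: nat.splits)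
  have A'_blk: "A' = blk l A3"
    using A' by (intro eq_matI) (auto simp: blk_def A3_def row0 col0)
  let ?V = "blk 1 V"
  have VT: "transpose_mat ?V = blk 1 (transpose_mat V)" using blk_transpose V by blast
  have V': "?V \<in> carrier_mat ?N ?N" "transpose_mat ?V \<in> carrier_mat ?N ?N" using blk V(1) by auto
  have VV: "transpose_mat ?V * ?V = 1\<^sub>m ?N" "?V * transpose_mat ?V = 1\<^sub>m ?N"
    using V by (auto simp: VT blk_mult blk_one)
  have A'V: "A' = ?V * mat_diag ?N f * transpose_mat ?V"
    unfolding A'_blk V(4) VT blk_diag[symmetric] using V by (simp add: blk_mult)
  define U where "U = H * ?V"
  have UT: "transpose_mat U = transpose_mat ?V * H"
    using transpose_mult[OF H(1) V'(1)] H(2) by (simp add: U_def)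
  have "transpose_mat U * U = transpose_mat ?V * (H * H) * ?V"
    unfolding UT using H(1) V' by (simp add: U_def assoc_mult_mat[of _ ?N ?N _ ?N _ ?N])
  hence UTU: "transpose_mat U * U = 1\<^sub>m ?N" using VV V' by (simp add: H(3))
  have "U * transpose_mat U = H * (?V * transpose_mat ?V) * H"
    unfolding UT using H(1) V' by (simp add: U_def assoc_mult_mat[of _ ?N ?N _ ?N _ ?N])
  hence UUT: "U * transpose_mat U = 1\<^sub>m ?N" using VV H by simp
  have "A = (H * H) * A * (H * H)" using A H(3) by simp
  hence "A = H * A' * H"
    using A(1) H(1) by (simp add: A'_def assoc_mult_mat[of _ ?N ?N _ ?N _ ?N])
  moreover define E where "E = mat_diag ?N f"
  have "E \<in> carrier_mat ?N ?N" by (simp add: E_def)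
  ultimately have "A = U * mat_diag ?N f * transpose_mat U"
    unfolding UT E_def[symmetric] using H(1) V'
    by (simp add: A'V[folded E_def] U_def assoc_mult_mat[of _ ?N ?N _ ?N _ ?N])
  moreover have "U \<in> carrier_mat ?N ?N" using H(1) V'(1) by (simp add: U_def)
  ultimately show ?case using UTU UUT by blast
qed

section \<open>Square roots and the spectral norm\<close>

lemma mat_eqI_unit_vec:
  fixes A B :: "real mat"
  assumes "A \<in> carrier_mat n m" "B \<in> carrier_mat n m"
    and eq: "\<And>j. j < m \<Longrightarrow> A *\<^sub>v unit_vec m j = B *\<^sub>v unit_vec m j"
  shows "A = B"
proof (rule eq_matI)
  fix i j assume "i < dim_row B" "j < dim_col B"
  hence "i < n" "j < m" using assms by auto
  thus "A $$ (i, j) = B $$ (i, j)"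
    using mult_unit_vec_index[OF assms(1)] mult_unit_vec_index[OF assms(2)] eq by metis
qed (use assms(1,2) in auto)

lemma isometry_scalar_prod:
  fixes U :: "real mat"
  assumes "U \<in> carrier_mat n n" "transpose_mat U * U = 1\<^sub>m n" "y \<in> carrier_vec n" "z \<in> carrier_vec n"
  shows "(U *\<^sub>v y) \<bullet> (U *\<^sub>v z) = y \<bullet> z"
proof -
  have "(U *\<^sub>v y) \<bullet> (U *\<^sub>v z) = (transpose_mat U *\<^sub>v (U *\<^sub>v y)) \<bullet> z"
    using transpose_vec_mult_scalar[of U n n z "U *\<^sub>v y"] assms by simp
  also have "transpose_mat U *\<^sub>v (U *\<^sub>v y) = y"
    using assoc_mult_mat_vec[of "transpose_mat U" n n U n y] assms by simp
  finally show ?thesis .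
qed

lemma mat_diag_mult_vec_carrier [simp]: "mat_diag n f *\<^sub>v y \<in> carrier_vec n"
  unfolding carrier_vec_def mat_diag_def by simp

lemma mat_diag_mult_vec:
  fixes y :: "real vec"
  assumes "y \<in> carrier_vec n"
  shows "mat_diag n f *\<^sub>v y = vec n (\<lambda>i. f i * y $ i)"
proof (rule eq_vecI)
  fix i assume "i < dim_vec (vec n (\<lambda>i. f i * y $ i))"
  hence i: "i < n" by simp
  have "(mat_diag n f *\<^sub>v y) $ i = (\<Sum>j<n. (if i = j then f j else 0) * y $ j)"
    using i assms by (simp add: mat_diag_def scalar_prod_def atLeast0LessThan)
  also have "\<dots> = (\<Sum>j<n. if j = i then f i * y $ i else 0)"
    by (rule sum.cong) auto
  finally show "(mat_diag n f *\<^sub>v y) $ i = vec n (\<lambda>i. f i * y $ i) $ i" using i by simp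
qed (simp add: mat_diag_def)

lemma diagonalized_eigenvector:
  fixes U :: "real mat"
  assumes "U \<in> carrier_mat n n" "transpose_mat U * U = 1\<^sub>m n" "i < n"
  shows "(U * mat_diag n f * transpose_mat U) *\<^sub>v (U *\<^sub>v unit_vec n i) = f i \<cdot>\<^sub>v (U *\<^sub>v unit_vec n i)"
proof -
  let ?u = "U *\<^sub>v unit_vec n i"
  have "transpose_mat U *\<^sub>v ?u = unit_vec n i"
    using assoc_mult_mat_vec[of "transpose_mat U" n n U n "unit_vec n i"] assms by simp
  moreover have "mat_diag n f *\<^sub>v unit_vec n i = f i \<cdot>\<^sub>v unit_vec n i"
    using assms(3) by (subst mat_diag_mult_vec) (auto intro!: eq_vecI)
  moreover have "(U * mat_diag n f * transpose_mat U) *\<^sub>v ?u = U *\<^sub>v (mat_diag n f *\<^sub>v (transpose_mat U *\<^sub>v ?u))"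
    using assms by (simp add: assoc_mult_mat_vec[of _ n n _ n])
  ultimately show ?thesis using assms by (simp add: mult_mat_vec[of _ n n])
qed

lemma diagonalized_quadratic_form:
  fixes U :: "real mat"
  assumes "U \<in> carrier_mat n n" "x \<in> carrier_vec n"
  shows "x \<bullet> ((U * mat_diag n f * transpose_mat U) *\<^sub>v x) = 
    (\<Sum>i<n. f i * ((transpose_mat U *\<^sub>v x) $ i)\<^sup>2)"
proof -
  let ?z = "transpose_mat U *\<^sub>v x"
  have z: "?z \<in> carrier_vec n" using assms by simp
  have "(U * mat_diag n f * transpose_mat U) *\<^sub>v x = U *\<^sub>v (mat_diag n f *\<^sub>v ?z)"
    using assms by (simp add: assoc_mult_mat_vec[of _ n n _ n])
  hence "x \<bullet> ((U * mat_diag n f * transpose_mat U) *\<^sub>v x) = ?z \<bullet> (mat_diag n f *\<^sub>v ?z)"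
    using transpose_vec_mult_scalar[OF assms(1) mat_diag_mult_vec_carrier assms(2)] by metis
  also have "\<dots> = (\<Sum>i<n. f i * (?z $ i)\<^sup>2)"
    unfolding mat_diag_mult_vec[OF z]
    by (simp add: scalar_prod_def atLeast0LessThan power2_eq_square mult_ac del: index_mult_mat_vec)
  finally show ?thesis .
qed

lemma spd_matD:
  assumes "spd_mat n M"
  shows "M \<in> carrier_mat n n" "transpose_mat M = M"
    "\<And>x. x \<in> carrier_vec n \<Longrightarrow> x \<noteq> 0\<^sub>v n \<Longrightarrow> x \<bullet> (M *\<^sub>v x) > 0"
  using assms unfolding spd_mat_def by blast+

lemma isometry_unit_vec_nonzero:
  fixes U :: "real mat"
  assumes "U \<in> carrier_mat n n" "transpose_mat U * U = 1\<^sub>m n" "i < n"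
  shows "U *\<^sub>v unit_vec n i \<noteq> 0\<^sub>v n"
proof
  assume "U *\<^sub>v unit_vec n i = 0\<^sub>v n"
  with isometry_scalar_prod[OF assms(1,2), of "unit_vec n i" "unit_vec n i"]
  show False using assms(3) by simp
qed

lemma spd_sqrt_exists:
  assumes M: "spd_mat n M"
  shows "\<exists>S. spd_mat n S \<and> S * S = M"
proof -
  obtain U f where U: "U \<in> carrier_mat n n" "transpose_mat U * U = 1\<^sub>m n" "U * transpose_mat U = 1\<^sub>m n"
    "M = U * mat_diag n f * transpose_mat U"
    using symmetric_mat_spectral spd_matD[OF M] by blast
  have f: "f i > 0" if "i < n" for i
  proof -
    let ?u = "U *\<^sub>v unit_vec n i"
    have "0 < ?u \<bullet> (M *\<^sub>v ?u)" 
      using isometry_unit_vec_nonzero[OF U(1,2) that] U(1) by (intro spd_matD(3)[OF M]) auto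
    also have "\<dots> = f i * (?u \<bullet> ?u)"
      using diagonalized_eigenvector[OF U(1,2) that, of f] U(1) by (simp add: U(4))
    finally show ?thesis using scalar_prod_self_nonneg[of ?u] by (simp add: zero_less_mult_iff)
  qed
  define E where "E = mat_diag n (\<lambda>i. sqrt (f i))"
  have E: "E \<in> carrier_mat n n" "transpose_mat E = E"
    by (auto simp: E_def mat_diag_def intro!: eq_matI)
  have EE: "E * E = mat_diag n f"
    using f unfolding E_def mat_diag_diag by (intro eq_matI) (auto simp: mat_diag_def less_imp_le)
  define W where "W = transpose_mat U"
  have W: "W \<in> carrier_mat n n" using U(1) by (simp add: W_def)
  define S where "S = U * E * W"
  have S: "S \<in> carrier_mat n n" using U(1) E W by (simp add: S_def)
  have "S * S = U * (E * (W * U) * E) * W"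
    using U(1) E(1) W by (simp add: S_def assoc_mult_mat[of _ n n _ n _ n])
  also have "E * (W * U) * E = mat_diag n f"
    using U(2) EE E(1) by (simp add: W_def)
  finally have "S * S = M" using U(4) by (simp add: W_def)
  moreover have "spd_mat n S"
    unfolding spd_mat_def
  proof (intro conjI ballI impI)
    show "transpose_mat S = S"
      using symmetric_mat_congruence[OF E W] by (simp add: S_def W_def)
    fix x :: "real vec" assume x: "x \<in> carrier_vec n" "x \<noteq> 0\<^sub>v n"
    let ?z = "transpose_mat U *\<^sub>v x"
    have z: "?z \<in> carrier_vec n" using U(1) x by simp
    have "U *\<^sub>v ?z = x" using assoc_mult_mat_vec[of U n n "transpose_mat U" n x] U x by simp
    hence "?z \<noteq> 0\<^sub>v n" using mult_mat_zero_vec[OF U(1)] x(2) by metis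
    then obtain i where i: "i < n" "?z $ i \<noteq> 0" using nonzero_vec_entry[OF z] by blast
    have "0 < (\<Sum>i<n. sqrt (f i) * (?z $ i)\<^sup>2)"
      using i f by (intro sum_pos2[of _ i]) (auto simp: less_imp_le simp del: index_mult_mat_vec)
    thus "0 < x \<bullet> (S *\<^sub>v x)"
      using diagonalized_quadratic_form[OF U(1) x(1), of "\<lambda>i. sqrt (f i)"]
      by (simp add: S_def W_def E_def)
  qed (use S in auto)
  ultimately show ?thesis by blast
qed

text \<open>
  If \<open>T u = t u\<close> with \<open>t > 0\<close>, then \<open>(S + t) (S - t) u = (S\<^sup>2 - T\<^sup>2) u = 0\<close>. Since \<open>S + t\<close> is
  positive definite, \<open>S u = t u\<close>; so \<open>S\<close> and \<open>T\<close> agree on an eigenbasis of \<open>T\<close>.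
\<close>
lemma spd_sqrt_unique:
  assumes S: "spd_mat n S" and T: "spd_mat n T" and eq: "S * S = T * T"
  shows "S = T"
proof -
  note Sc = spd_matD(1)[OF S] and Tc = spd_matD(1)[OF T]
  obtain U f where U: "U \<in> carrier_mat n n" "transpose_mat U * U = 1\<^sub>m n" "U * transpose_mat U = 1\<^sub>m n"
    "T = U * mat_diag n f * transpose_mat U"
    using symmetric_mat_spectral spd_matD[OF T] by blast
  have "S *\<^sub>v (U *\<^sub>v unit_vec n i) = T *\<^sub>v (U *\<^sub>v unit_vec n i)" if i: "i < n" for i
  proof -
    define u where "u = U *\<^sub>v unit_vec n i"
    have u: "u \<in> carrier_vec n" "u \<noteq> 0\<^sub>v n" 
      using U(1) isometry_unit_vec_nonzero[OF U(1,2) i] by (auto simp: u_def)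
    have Tu: "T *\<^sub>v u = f i \<cdot>\<^sub>v u" using diagonalized_eigenvector[OF U(1,2) i] U(4) by (simp add: u_def)
    have "0 < u \<bullet> (T *\<^sub>v u)" using spd_matD(3)[OF T] u by blast
    also have "\<dots> = f i * (u \<bullet> u)" using Tu u by simp
    finally have fi: "f i > 0" using scalar_prod_self_nonneg[of u] by (simp add: zero_less_mult_iff)
    have "S *\<^sub>v (S *\<^sub>v u) = T *\<^sub>v (T *\<^sub>v u)"
      using assoc_mult_mat_vec[OF Sc Sc u(1)] assoc_mult_mat_vec[OF Tc Tc u(1)] eq by simp
    also have "\<dots> = f i \<cdot>\<^sub>v (f i \<cdot>\<^sub>v u)" by (simp add: Tu mult_mat_vec[OF Tc u(1)])
    finally have SSu: "S *\<^sub>v (S *\<^sub>v u) = f i \<cdot>\<^sub>v (f i \<cdot>\<^sub>v u)" .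
    \<comment> \<open>\<open>w\<close> satisfies \<open>S w = - t w\<close> with \<open>t = f i\<close>, which positivity of \<open>S\<close> and \<open>t\<close> permits only for \<open>w = 0\<close>.\<close>
    define w where "w = S *\<^sub>v u - f i \<cdot>\<^sub>v u"
    have Su: "S *\<^sub>v u \<in> carrier_vec n" using Sc u by simp
    have w: "w \<in> carrier_vec n" using Su u by (simp add: w_def)
    have "S *\<^sub>v w = S *\<^sub>v (S *\<^sub>v u) - f i \<cdot>\<^sub>v (S *\<^sub>v u)"
      unfolding w_def using u(1) Su 
      by (subst mult_minus_distrib_mat_vec[OF Sc]) (auto simp: mult_mat_vec[OF Sc u(1)])
    also have "\<dots> = (- f i) \<cdot>\<^sub>v w"
      unfolding SSu w_def using u(1) carrier_vecD[OF Su]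
      by (intro eq_vecI) (auto simp: algebra_simps simp del: index_mult_mat_vec dim_mult_mat_vec)
    finally have "S *\<^sub>v w = (- f i) \<cdot>\<^sub>v w" .
    hence "w \<bullet> (S *\<^sub>v w) = - f i * (w \<bullet> w)" using w by simp
    hence "w \<bullet> (S *\<^sub>v w) \<le> 0" using fi scalar_prod_self_nonneg[of w] by simp
    hence w0: "w = 0\<^sub>v n" using spd_matD(3)[OF S w] by fastforce
    have "(S *\<^sub>v u) $ j = (f i \<cdot>\<^sub>v u) $ j" if "j < n" for j
      using arg_cong[OF w0, of "\<lambda>x. x $ j"] that u Su by (simp add: w_def del: index_mult_mat_vec)
    hence "S *\<^sub>v u = f i \<cdot>\<^sub>v u"
      using u(1) carrier_vecD[OF Su] by (intro eq_vecI) (auto simp del: dim_mult_mat_vec)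
    thus ?thesis using Tu by (simp add: u_def)
  qed
  hence "(S * U) *\<^sub>v unit_vec n i = (T * U) *\<^sub>v unit_vec n i" if "i < n" for i
    using that Sc Tc U(1) by (simp add: assoc_mult_mat_vec[of _ n n _ n])
  hence SU: "S * U = T * U"
    using Sc Tc U(1) by (intro mat_eqI_unit_vec[of _ n n]) auto
  have "S = (S * U) * transpose_mat U" using Sc U(1,3) by (simp add: assoc_mult_mat[of _ n n _ n _ n])
  also have "\<dots> = T" unfolding SU using Tc U(1,3) by (simp add: assoc_mult_mat[of _ n n _ n _ n])
  finally show ?thesis .
qed

lemma spd_sqrt:
  assumes "spd_mat n M"
  shows "spd_mat n (spd_sqrt M)" "spd_sqrt M * spd_sqrt M = M"
proof -
  have "\<exists>!S. spd_mat (dim_row M) S \<and> S * S = M"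
    using spd_sqrt_exists[OF assms] spd_sqrt_unique spd_matD(1)[OF assms] by auto
  from theI'[OF this] show "spd_mat n (spd_sqrt M)" "spd_sqrt M * spd_sqrt M = M"
    using spd_matD(1)[OF assms] by (auto simp: spd_sqrt_def)
qed

lemma mat_inv:
  fixes A :: "'a :: field mat"
  assumes A: "A \<in> carrier_mat n n"
    and inj: "\<And>v. v \<in> carrier_vec n \<Longrightarrow> A *\<^sub>v v = 0\<^sub>v n \<Longrightarrow> v = 0\<^sub>v n"
  shows "mat_inv A \<in> carrier_mat n n" "A * mat_inv A = 1\<^sub>m n" "mat_inv A * A = 1\<^sub>m n"
proof -
  have "det A \<noteq> 0" using det_0_iff_vec_prod_zero_field[OF A] inj by blast
  hence "A \<in> Units (ring_mat TYPE('a) n ())" by (rule det_non_zero_imp_unit[OF A])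
  then obtain B where "mat_inverse A = Some B" using mat_inverse(1)[OF A] by fastforce
  with mat_inverse(2)[OF A] 
  show "mat_inv A \<in> carrier_mat n n" "A * mat_inv A = 1\<^sub>m n" "mat_inv A * A = 1\<^sub>m n"
    by (auto simp: mat_inv_def)
qed

text \<open>
  The strict bound on the quadratic form holds pointwise; to pass to a strict bound on the supremum,
  one uses that it is governed by the finitely many eigenvalues, whose largest modulus is
  itself less than 1.
\<close>
lemma spectral_norm_symmetric_less_one:
  fixes K :: "real mat"
  assumes K: "K \<in> carrier_mat n n" "transpose_mat K = K" and n: "n > 0"
    and small: "\<And>x. x \<in> carrier_vec n \<Longrightarrow> x \<noteq> 0\<^sub>v n \<Longrightarrow> \<bar>x \<bullet> (K *\<^sub>v x)\<bar> < x \<bullet> x"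
  shows "0 \<le> spectral_norm K" "spectral_norm K < 1"
    "\<And>y. y \<in> carrier_vec n \<Longrightarrow> (K *\<^sub>v y) \<bullet> (K *\<^sub>v y) \<le> (spectral_norm K)\<^sup>2 * (y \<bullet> y)"
proof -
  obtain U f where U: "U \<in> carrier_mat n n" "transpose_mat U * U = 1\<^sub>m n" "U * transpose_mat U = 1\<^sub>m n"
    "K = U * mat_diag n f * transpose_mat U"
    using symmetric_mat_spectral K by blast
  have f: "\<bar>f i\<bar> < 1" if "i < n" for i
  proof -
    let ?u = "U *\<^sub>v unit_vec n i"
    have u: "?u \<in> carrier_vec n" using U(1) by simp
    have 1: "?u \<bullet> ?u = 1" using isometry_scalar_prod[OF U(1,2), of "unit_vec n i" "unit_vec n i"] that by simp
    have "\<bar>?u \<bullet> (K *\<^sub>v ?u)\<bar> < ?u \<bullet> ?u"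
      using isometry_unit_vec_nonzero[OF U(1,2) that] u by (intro small)
    also have "?u \<bullet> (K *\<^sub>v ?u) = f i * (?u \<bullet> ?u)"
      using diagonalized_eigenvector[OF U(1,2) that, of f] u by (simp add: U(4))
    finally show ?thesis using 1 by simp
  qed
  define L where "L = Max ((\<lambda>i. \<bar>f i\<bar>) ` {..<n})"
  have ne: "{..<n} \<noteq> {}" using n by auto
  have L1: "L < 1" unfolding L_def using f ne by (subst Max_less_iff) auto
  have fL: "\<bar>f i\<bar> \<le> L" if "i < n" for i unfolding L_def using that by (intro Max_ge) auto
  have L0: "0 \<le> L" using fL[of 0] n by linarith
  have bound: "(K *\<^sub>v y) \<bullet> (K *\<^sub>v y) \<le> L\<^sup>2 * (y \<bullet> y)" if y: "y \<in> carrier_vec n" for y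
  proof -
    define z where "z = transpose_mat U *\<^sub>v y"
    have z: "z \<in> carrier_vec n" using U(1) y by (simp add: z_def)
    have UT: "transpose_mat U \<in> carrier_mat n n" using U(1) by simp
    have Dz: "mat_diag n f *\<^sub>v z \<in> carrier_vec n" by simp
    have "K *\<^sub>v y = U *\<^sub>v (mat_diag n f *\<^sub>v z)"
      using U(1) y by (simp add: U(4) z_def assoc_mult_mat_vec[of _ n n _ n])
    hence "(K *\<^sub>v y) \<bullet> (K *\<^sub>v y) = (mat_diag n f *\<^sub>v z) \<bullet> (mat_diag n f *\<^sub>v z)"
      using isometry_scalar_prod[OF U(1,2) Dz Dz] by simp
    also have "\<dots> = (\<Sum>i<n. (f i)\<^sup>2 * (z $ i)\<^sup>2)"
      unfolding mat_diag_mult_vec[OF z] 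
      by (simp add: scalar_prod_def atLeast0LessThan power2_eq_square mult_ac)
    also have "\<dots> \<le> (\<Sum>i<n. L\<^sup>2 * (z $ i)\<^sup>2)"
      using fL L0 by (intro sum_mono mult_right_mono) (auto simp flip: abs_le_square_iff)
    also have "\<dots> = L\<^sup>2 * (z \<bullet> z)"
      using z by (simp add: scalar_prod_def atLeast0LessThan power2_eq_square sum_distrib_left)
    also have "z \<bullet> z = y \<bullet> y"
      using isometry_scalar_prod[OF UT, of y y] U(3) y by (simp add: z_def)
    finally show ?thesis .
  qed
  let ?X = "{x \<in> carrier_vec (dim_col K). vec_l2_norm x = 1}"
  have XL: "vec_l2_norm (K *\<^sub>v x) \<le> L" if "x \<in> ?X" for x
    using bound[of x] that K L0 by (auto simp: vec_l2_norm_def real_sqrt_le_iff intro!: real_le_lsqrt)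
  have e: "unit_vec n 0 \<in> ?X" using K n by (auto simp: vec_l2_norm_def)
  have bdd: "bdd_above ((\<lambda>x. vec_l2_norm (K *\<^sub>v x)) ` ?X)" using XL by (intro bdd_aboveI2)
  have up: "vec_l2_norm (K *\<^sub>v x) \<le> spectral_norm K" if "x \<in> ?X" for x
    unfolding spectral_norm_def using that bdd by (intro cSUP_upper)
  have "spectral_norm K \<le> L" unfolding spectral_norm_def using e XL by (intro cSUP_least) auto
  with L1 show "spectral_norm K < 1" by linarith
  have "0 \<le> vec_l2_norm (K *\<^sub>v unit_vec n 0)" using scalar_prod_self_nonneg by (simp add: vec_l2_norm_def)
  with up[OF e] show d0: "0 \<le> spectral_norm K" by linarith
  fix y :: "real vec" assume y: "y \<in> carrier_vec n"
  show "(K *\<^sub>v y) \<bullet> (K *\<^sub>v y) \<le> (spectral_norm K)\<^sup>2 * (y \<bullet> y)"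
  proof (cases "y = 0\<^sub>v n")
    case True
    thus ?thesis using mult_mat_zero_vec[OF K(1)] by simp
  next
    case False
    hence pos: "y \<bullet> y > 0" using scalar_prod_self_pos y by blast
    let ?c = "1 / sqrt (y \<bullet> y)"
    have "?c \<cdot>\<^sub>v y \<in> ?X" using pos y K by (simp add: vec_l2_norm_def)
    from up[OF this] have "sqrt (?c * ?c * ((K *\<^sub>v y) \<bullet> (K *\<^sub>v y))) \<le> spectral_norm K"
      using y K by (simp add: mult_mat_vec[OF K(1) y] vec_l2_norm_def mult.assoc)
    hence "?c * ?c * ((K *\<^sub>v y) \<bullet> (K *\<^sub>v y)) \<le> (spectral_norm K)\<^sup>2"
      by (rule sqrt_le_D)
    thus ?thesis using pos by (simp add: field_simps)
  qed
qed

section \<open>The relative size of the imaginary part\<close>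

lemma spd_mat_add:
  assumes "spd_mat n P" "spd_mat n Q"
  shows "spd_mat n (P + Q)"
  unfolding spd_mat_def
proof (intro conjI ballI impI)
  note P = spd_matD[OF assms(1)] and Q = spd_matD[OF assms(2)]
  show "P + Q \<in> carrier_mat n n" using P(1) Q(1) by simp
  show "transpose_mat (P + Q) = P + Q" using transpose_add[OF P(1) Q(1)] P(2) Q(2) by simp
  fix x :: "real vec" assume x: "x \<in> carrier_vec n" "x \<noteq> 0\<^sub>v n"
  have "x \<bullet> ((P + Q) *\<^sub>v x) = x \<bullet> (P *\<^sub>v x) + x \<bullet> (Q *\<^sub>v x)"
    using P(1) Q(1) x(1)
    by (simp add: add_mult_distrib_mat_vec[of _ n n] scalar_prod_add_distrib[of _ n])
  thus "0 < x \<bullet> ((P + Q) *\<^sub>v x)" using P(3)[OF x] Q(3)[OF x] by simp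
qed

lemma spd_mat_inj:
  assumes "spd_mat n M" "v \<in> carrier_vec n" "M *\<^sub>v v = 0\<^sub>v n"
  shows "v = 0\<^sub>v n"
proof (rule ccontr)
  assume "v \<noteq> 0\<^sub>v n"
  from spd_matD(3)[OF assms(1,2) this] show False using assms(2,3) by simp
qed

text \<open>
  With \<open>S\<close> the square root of \<open>B + C\<close>, the matrix whose norm is \<open>higham_delta B C\<close> is
  \<open>K = S\<^sup>-\<^sup>1 (C - B) S\<^sup>-\<^sup>1\<close>. For \<open>x = S y\<close> the forms \<open>x \<bullet> x\<close> and \<open>x \<bullet> K x\<close> are the sum and the
  difference of \<open>y \<bullet> C y\<close> and \<open>y \<bullet> B y\<close>, both positive, which is why the norm of \<open>K\<close> stays
  below 1.
\<close>
lemma higham_delta_factorization: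
  assumes B: "spd_mat n B" and C: "spd_mat n C" and n: "n > 0"
  obtains S K where "spd_mat n S" "S * S = B + C"
    "K \<in> carrier_mat n n" "transpose_mat K = K" "S * K * S = C - B"
    "\<And>y. y \<in> carrier_vec n \<Longrightarrow> (K *\<^sub>v y) \<bullet> (K *\<^sub>v y) \<le> (higham_delta B C)\<^sup>2 * (y \<bullet> y)"
    "0 \<le> higham_delta B C" "higham_delta B C < 1"
proof -
  note Bc = spd_matD(1)[OF B] and Cc = spd_matD(1)[OF C]
  define S where "S = spd_sqrt (B + C)"
  have S: "spd_mat n S" "S * S = B + C" using spd_sqrt[OF spd_mat_add[OF B C]] by (auto simp: S_def)
  note Sc = spd_matD(1)[OF S(1)]
  define N where "N = mat_inv S"
  have N: "N \<in> carrier_mat n n" "S * N = 1\<^sub>m n" "N * S = 1\<^sub>m n"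
    using mat_inv[OF Sc spd_mat_inj[OF S(1)]] by (auto simp: N_def)
  have NT: "transpose_mat N = N"
  proof -
    have NTc: "transpose_mat N \<in> carrier_mat n n" using N(1) by simp
    have "transpose_mat N * S = 1\<^sub>m n"
      using transpose_mult[OF Sc N(1)] N(2) spd_matD(2)[OF S(1)] by simp
    hence "transpose_mat N = transpose_mat N * (S * N)" using N(2) NTc by simp
    also have "\<dots> = (transpose_mat N * S) * N" using assoc_mult_mat[OF NTc Sc N(1)] by simp
    also have "\<dots> = N" using \<open>transpose_mat N * S = 1\<^sub>m n\<close> N(1) by simp
    finally show ?thesis .
  qed
  define D where "D = C - B"
  have D: "D \<in> carrier_mat n n" "transpose_mat D = D"
    using Bc Cc transpose_minus[OF Cc Bc] spd_matD(2)[OF B] spd_matD(2)[OF C] by (auto simp: D_def)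
  define K where "K = N * D * N"
  have K: "K \<in> carrier_mat n n" using N(1) D(1) by (simp add: K_def)
  have KT: "transpose_mat K = K"
    using symmetric_mat_congruence[OF D N(1)] NT by (simp add: K_def)
  have "S * K * S = (S * N) * D * (N * S)"
    using Sc N(1) D(1) by (simp add: K_def assoc_mult_mat[of _ n n _ n _ n])
  hence "S * K * S = D" using N(2,3) D(1) by simp
  hence SKS: "S * K * S = C - B" by (simp add: D_def)
  have hd: "higham_delta B C = spectral_norm K"
    by (simp add: higham_delta_def mat_inv_sqrt_def K_def N_def S_def D_def)
  have small: "\<bar>x \<bullet> (K *\<^sub>v x)\<bar> < x \<bullet> x" if x: "x \<in> carrier_vec n" "x \<noteq> 0\<^sub>v n" for x
  proof -
    define y where "y = N *\<^sub>v x"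
    have y: "y \<in> carrier_vec n" using N(1) x by (simp add: y_def)
    have xy: "x = S *\<^sub>v y" using assoc_mult_mat_vec[OF Sc N(1) x(1)] N(2) x(1) by (simp add: y_def)
    have "y \<noteq> 0\<^sub>v n" using xy mult_mat_zero_vec[OF Sc] x(2) by metis
    hence pos: "y \<bullet> (B *\<^sub>v y) > 0" "y \<bullet> (C *\<^sub>v y) > 0" using spd_matD(3) B C y by blast+
    have "x \<bullet> x = y \<bullet> (S *\<^sub>v (S *\<^sub>v y))"
      using symmetric_mat_scalar_prod[OF Sc spd_matD(2)[OF S(1)] y, of x] x(1) xy by simp
    also have "\<dots> = y \<bullet> ((B + C) *\<^sub>v y)" using assoc_mult_mat_vec[OF Sc Sc y] S(2) by simp
    also have "\<dots> = y \<bullet> (B *\<^sub>v y) + y \<bullet> (C *\<^sub>v y)"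
      using Bc Cc y
      by (simp add: add_mult_distrib_mat_vec[of _ n n] scalar_prod_add_distrib[of _ n])
    finally have xx: "x \<bullet> x = y \<bullet> (B *\<^sub>v y) + y \<bullet> (C *\<^sub>v y)" .
    have Kx: "K *\<^sub>v x \<in> carrier_vec n" using K x by simp
    have "x \<bullet> (K *\<^sub>v x) = y \<bullet> (S *\<^sub>v (K *\<^sub>v (S *\<^sub>v y)))"
      using symmetric_mat_scalar_prod[OF Sc spd_matD(2)[OF S(1)] y Kx] xy by simp
    also have "S *\<^sub>v (K *\<^sub>v (S *\<^sub>v y)) = (S * K * S) *\<^sub>v y"
      using assoc_mult_mat_vec[OF mult_carrier_mat[OF Sc K] Sc y]
        assoc_mult_mat_vec[OF Sc K, of "S *\<^sub>v y"] Sc y by simp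
    also have "y \<bullet> ((S * K * S) *\<^sub>v y) = y \<bullet> (C *\<^sub>v y) - y \<bullet> (B *\<^sub>v y)"
      using Bc Cc y unfolding SKS
      by (simp add: minus_mult_distrib_mat_vec[of _ n n] scalar_prod_minus_distrib[of _ n])
    finally show ?thesis using xx pos by linarith
  qed
  show ?thesis
    using that[OF S K KT SKS] spectral_norm_symmetric_less_one[OF K KT n small] unfolding hd by blast
qed

section \<open>Schur complements and the growth of their entries\<close>

text \<open>
  Symmetry of \<open>Q\<close> makes the two cross terms in the real part of \<open>x\<^sup>* (P + iQ) x\<close> cancel.
\<close>
lemma complex_mat_energy:
  assumes P: "P \<in> carrier_mat n n" and Q: "Q \<in> carrier_mat n n" "transpose_mat Q = Q"
    and x: "x \<in> carrier_vec n"
  shows "map_vec Re x \<bullet> map_vec Re (complex_mat P Q *\<^sub>v x) + map_vec Im x \<bullet> map_vec Im (complex_mat P Q *\<^sub>v x) =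
    map_vec Re x \<bullet> (P *\<^sub>v map_vec Re x) + map_vec Im x \<bullet> (P *\<^sub>v map_vec Im x)"
proof -
  define a b where "a = map_vec Re x" and "b = map_vec Im x"
  have a: "a \<in> carrier_vec n" and b: "b \<in> carrier_vec n" using x by (auto simp: a_def b_def)
  have c: "P *\<^sub>v a \<in> carrier_vec n" "P *\<^sub>v b \<in> carrier_vec n" "Q *\<^sub>v a \<in> carrier_vec n" "Q *\<^sub>v b \<in> carrier_vec n"
    using P Q a b by auto
  have "a \<bullet> (Q *\<^sub>v b) = b \<bullet> (Q *\<^sub>v a)"
    using symmetric_mat_scalar_prod[OF Q a b] comm_scalar_prod[OF b c(3)] by simp
  thus ?thesis
    unfolding complex_mat_mult_vec[OF P Q(1) x] a_def[symmetric] b_def[symmetric]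
    using scalar_prod_minus_distrib[OF a c(1) c(4)] scalar_prod_add_distrib[OF b c(2) c(3)] by simp
qed

text \<open>
  A kernel vector of a leading principal block, extended by zeros, has \<open>x\<^sup>* (B + iC) x = 0\<close>; the
  real part of this is a sum of values of the positive definite form of \<open>B\<close>.
\<close>
lemma higham_leading_block_inj:
  assumes B: "spd_mat n B" and C: "spd_mat n C" and x: "x \<in> carrier_vec n"
    and supp: "\<And>l. k \<le> l \<Longrightarrow> l < n \<Longrightarrow> x $ l = 0"
    and zero: "\<And>l. l < k \<Longrightarrow> l < n \<Longrightarrow> (complex_mat B C *\<^sub>v x) $ l = 0"
  shows "x = 0\<^sub>v n"
proof -
  note Bc = spd_matD(1)[OF B] and Cc = spd_matD(1)[OF C]
  define z where "z = complex_mat B C *\<^sub>v x"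
  have z: "z \<in> carrier_vec n" 
    using mult_mat_vec_carrier[OF complex_mat_carrier[OF Bc Cc] x] by (simp add: z_def)
  have ab: "map_vec Re x \<in> carrier_vec n" "map_vec Im x \<in> carrier_vec n" using x by auto
  have xz: "Re (x $ l) * Re (z $ l) = 0" "Im (x $ l) * Im (z $ l) = 0" if "l < n" for l
    using supp[of l] zero[of l] that by (cases "l < k"; simp add: z_def)+
  have "map_vec Re x \<bullet> map_vec Re z = 0" "map_vec Im x \<bullet> map_vec Im z = 0"
    unfolding scalar_prod_def using x z xz by (intro sum.neutral; simp)+
  hence sum0: "map_vec Re x \<bullet> (B *\<^sub>v map_vec Re x) + map_vec Im x \<bullet> (B *\<^sub>v map_vec Im x) = 0"
    using complex_mat_energy[OF Bc Cc spd_matD(2)[OF C] x] by (simp add: z_def)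
  have nonneg: "y \<bullet> (B *\<^sub>v y) \<ge> 0" if "y \<in> carrier_vec n" for y
    using spd_matD(3)[OF B that] mult_mat_zero_vec[OF Bc] by (cases "y = 0\<^sub>v n") (auto simp: less_imp_le)
  have re: "map_vec Re x = 0\<^sub>v n" and im: "map_vec Im x = 0\<^sub>v n"
    using sum0 nonneg[OF ab(1)] nonneg[OF ab(2)] spd_matD(3)[OF B ab(1)] spd_matD(3)[OF B ab(2)]
    by fastforce+
  show ?thesis
  proof (rule eq_vecI)
    fix l assume "l < dim_vec (0\<^sub>v n :: complex vec)"
    thus "x $ l = 0\<^sub>v n $ l"
      using arg_cong[OF re, of "\<lambda>v. v $ l"] arg_cong[OF im, of "\<lambda>v. v $ l"] x
      by (simp add: complex_eq_iff)
  qed (use x in simp)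
qed

text \<open>
  Column \<open>j\<close> of the Schur complement is read off from \<open>A x\<close> for the vector \<open>x\<close> that has the unit
  vector \<open>e\<^sub>j\<close> in its lower part and \<open>- A\<^sub>1\<^sub>1\<^sup>-\<^sup>1 A\<^sub>1\<^sub>2 e\<^sub>j\<close> in its upper part. This replaces the
  Schur complement by a statement about the full matrix. The hypothesis says that
  the leading block is nonsingular, with its vectors padded by zeros.
\<close>
lemma active_mat_as_image:
  fixes A :: "'a :: field mat"
  assumes A: "A \<in> carrier_mat n n" and k: "k \<le> n"
    and inj: "\<forall>x \<in> carrier_vec n. (\<forall>l. k \<le> l \<longrightarrow> l < n \<longrightarrow> x $ l = 0) \<longrightarrow>
      (\<forall>l<k. (A *\<^sub>v x) $ l = 0) \<longrightarrow> x = 0\<^sub>v n"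
  shows "active_mat A k \<in> carrier_mat (n - k) (n - k)"
    "\<And>j. j < n - k \<Longrightarrow> \<exists>x \<in> carrier_vec n. x $ (k + j) = 1 \<and>
      (\<forall>l<n. k \<le> l \<longrightarrow> l \<noteq> k + j \<longrightarrow> x $ l = 0) \<and>
      (\<forall>l<k. (A *\<^sub>v x) $ l = 0) \<and>
      (\<forall>i<n - k. (A *\<^sub>v x) $ (k + i) = active_mat A k $$ (i, j))"
proof -
  obtain A11 A12 A21 A22 where split: "split_block A k k = (A11, A12, A21, A22)"
    by (metis prod_cases4)
  let ?m = "n - k"
  have "dim_row A = k + ?m" "dim_col A = k + ?m" using A k by auto
  from split_block[OF split this]
  have c: "A11 \<in> carrier_mat k k" "A12 \<in> carrier_mat k ?m" "A21 \<in> carrier_mat ?m k" "A22 \<in> carrier_mat ?m ?m"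
    and Ablk: "A = four_block_mat A11 A12 A21 A22" by auto
  have Amult: "A *\<^sub>v (u @\<^sub>v w) = (A11 *\<^sub>v u + A12 *\<^sub>v w) @\<^sub>v (A21 *\<^sub>v u + A22 *\<^sub>v w)"
    if "u \<in> carrier_vec k" "w \<in> carrier_vec ?m" for u w
    unfolding Ablk using four_block_mat_mult_vec[OF c that] .
  have "u = 0\<^sub>v k" if u: "u \<in> carrier_vec k" "A11 *\<^sub>v u = 0\<^sub>v k" for u
  proof -
    let ?x = "u @\<^sub>v 0\<^sub>v ?m"
    have x0: "?x = 0\<^sub>v n"
    proof (rule inj[rule_format])
      show "?x \<in> carrier_vec n" using u(1) k by (metis append_carrier_vec le_add_diff_inverse zero_carrier_vec)
      show "?x $ l = 0" if "k \<le> l" "l < n" for l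
        using that u(1) by simp
      show "(A *\<^sub>v ?x) $ l = 0" if "l < k" for l
        using that u c mult_mat_zero_vec[OF c(2)] by (simp add: Amult del: index_mult_mat_vec)
    qed
    have "u $ l = 0" if "l < k" for l
      using arg_cong[OF x0, of "\<lambda>x. x $ l"] that u(1) k by simp
    thus ?thesis using u(1) by (intro eq_vecI) auto
  qed
  from mat_inv[OF c(1) this] 
  have I: "mat_inv A11 \<in> carrier_mat k k" "A11 * mat_inv A11 = 1\<^sub>m k" by auto
  define V where "V = mat_inv A11 * A12"
  have V: "V \<in> carrier_mat k ?m" using I c by (simp add: V_def)
  have act: "active_mat A k = A22 - A21 * V"
    using assoc_mult_mat[OF c(3) I(1) c(2)] by (simp add: active_mat_def split V_def)
  show "active_mat A k \<in> carrier_mat ?m ?m" unfolding act using c(3) V by (intro minus_carrier_mat mult_carrier_mat)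
  fix j assume j: "j < ?m"
  define w :: "'a vec" where "w = unit_vec ?m j"
  have w: "w \<in> carrier_vec ?m" by (simp add: w_def)
  define u where "u = - (V *\<^sub>v w)"
  have Vw: "V *\<^sub>v w \<in> carrier_vec k" using V w by simp
  have u: "u \<in> carrier_vec k" using Vw by (simp add: u_def)
  have neg: "X *\<^sub>v u = - (X *\<^sub>v (V *\<^sub>v w))" if "X \<in> carrier_mat r k" for X r
  proof -
    have "u = (-1) \<cdot>\<^sub>v (V *\<^sub>v w)" by (rule eq_vecI) (auto simp: u_def)
    hence "X *\<^sub>v u = (-1) \<cdot>\<^sub>v (X *\<^sub>v (V *\<^sub>v w))" using mult_mat_vec[OF that Vw] by simp
    thus ?thesis by (intro eq_vecI) auto
  qed
  have "A11 * V = A12" unfolding V_def using assoc_mult_mat[OF c(1) I(1) c(2)] I(2) c(2) by simp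
  hence "A11 *\<^sub>v u = - (A12 *\<^sub>v w)" using neg[OF c(1)] assoc_mult_mat_vec[OF c(1) V w] by simp
  hence top: "A11 *\<^sub>v u + A12 *\<^sub>v w = 0\<^sub>v k"
    using c(2) w by (intro eq_vecI) auto
  have "A21 *\<^sub>v u = - ((A21 * V) *\<^sub>v w)" using neg[OF c(3)] assoc_mult_mat_vec[OF c(3) V w] by simp
  hence bot: "A21 *\<^sub>v u + A22 *\<^sub>v w = active_mat A k *\<^sub>v w"
    unfolding act using c V w
    by (simp add: minus_mult_distrib_mat_vec[of _ ?m ?m]) (intro eq_vecI, auto)
  let ?x = "u @\<^sub>v w"
  have Ax: "A *\<^sub>v ?x = 0\<^sub>v k @\<^sub>v (active_mat A k *\<^sub>v w)" using Amult[OF u w] top bot by simp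
  have dimact: "dim_row (active_mat A k) = ?m" "dim_col (active_mat A k) = ?m"
    using \<open>active_mat A k \<in> carrier_mat ?m ?m\<close> by auto
  show "\<exists>x \<in> carrier_vec n. x $ (k + j) = 1 \<and>
      (\<forall>l<n. k \<le> l \<longrightarrow> l \<noteq> k + j \<longrightarrow> x $ l = 0) \<and>
      (\<forall>l<k. (A *\<^sub>v x) $ l = 0) \<and>
      (\<forall>i<n - k. (A *\<^sub>v x) $ (k + i) = active_mat A k $$ (i, j))"
  proof (intro bexI[of _ ?x] conjI allI impI)
    show "?x \<in> carrier_vec n" using u w k by (metis append_carrier_vec le_add_diff_inverse)
    show "?x $ (k + j) = 1" using u w j by (simp add: w_def)
    show "?x $ l = 0" if "l < n" "k \<le> l" "l \<noteq> k + j" for l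
      using that u w j by (auto simp: w_def)
    show "(A *\<^sub>v ?x) $ l = 0" if "l < k" for l unfolding Ax using that by simp
    show "(A *\<^sub>v ?x) $ (k + i) = active_mat A k $$ (i, j)" if "i < ?m" for i
      unfolding Ax using that j dimact by (simp add: w_def)
  qed
qed

text \<open>
  Multiplication by \<open>1 - i\<close> turns the Higham matrix \<open>B + iC\<close> into \<open>(B + C) + i (C - B)\<close>, whose
  imaginary part is small relative to its real part: this is where \<open>higham_delta\<close> comes from.
\<close>
lemma complex_mat_rotate:
  assumes "B \<in> carrier_mat n m" "C \<in> carrier_mat n m" "x \<in> carrier_vec m" "i < n"
  shows "(complex_mat (B + C) (C - B) *\<^sub>v x) $ i = (1 - \<i>) * (complex_mat B C *\<^sub>v x) $ i"
proof -
  have c: "complex_mat B C \<in> carrier_mat n m" "complex_mat (B + C) (C - B) \<in> carrier_mat n m"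
    using assms minus_carrier_mat[OF assms(1)] by auto
  have "row (complex_mat (B + C) (C - B)) i = (1 - \<i>) \<cdot>\<^sub>v row (complex_mat B C) i"
    using assms c by (intro eq_vecI) (auto simp: complex_mat_def complex_eq_iff)
  thus ?thesis
    using assms(3,4) by (simp add: carrier_matD[OF c(1)] carrier_matD[OF c(2)])
qed

text \<open>
  Write \<open>W = S (1 + iK) S\<close>. The \<open>i\<close>-th entry of \<open>W x\<close> is the product of \<open>S e\<^sub>i\<close>, whose squared
  length is the \<open>i\<close>-th diagonal entry of \<open>S\<^sup>2\<close>, with \<open>(1 + iK) S x\<close>. As \<open>K\<close> is real symmetric,
  \<open>1 + iK\<close> is normal and \<open>|(1 + iK) y|\<^sup>2 = |y|\<^sup>2 + |K y|\<^sup>2\<close>, which is at most \<open>(1 + d\<^sup>2) |y|\<^sup>2\<close>;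
  conclude with the Cauchy-Schwarz inequality. The last factor is the real part of \<open>x\<^sup>* W x\<close>.
\<close>
lemma accretive_entry_bound:
  assumes S: "spd_mat n S" and K: "K \<in> carrier_mat n n" "transpose_mat K = K"
    and bound: "\<And>y. y \<in> carrier_vec n \<Longrightarrow> (K *\<^sub>v y) \<bullet> (K *\<^sub>v y) \<le> d\<^sup>2 * (y \<bullet> y)"
    and x: "x \<in> carrier_vec n" and i: "i < n"
  shows "(cmod ((complex_mat (S * S) (S * K * S) *\<^sub>v x) $ i))\<^sup>2 \<le>
    (S * S) $$ (i, i) * ((1 + d\<^sup>2) *
      (map_vec Re x \<bullet> ((S * S) *\<^sub>v map_vec Re x) + map_vec Im x \<bullet> ((S * S) *\<^sub>v map_vec Im x)))"
proof -
  note Sc = spd_matD(1)[OF S] and ST = spd_matD(2)[OF S]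
  have SSc: "S * S \<in> carrier_mat n n" and SKc: "S * K \<in> carrier_mat n n" and SKSc: "S * K * S \<in> carrier_mat n n"
    using Sc K by auto
  define a b where "a = map_vec Re x" and "b = map_vec Im x"
  have a: "a \<in> carrier_vec n" and b: "b \<in> carrier_vec n" using x by (auto simp: a_def b_def)
  define a' b' where "a' = S *\<^sub>v a" and "b' = S *\<^sub>v b"
  have a': "a' \<in> carrier_vec n" and b': "b' \<in> carrier_vec n" using Sc a b by (auto simp: a'_def b'_def)
  have Ka: "K *\<^sub>v a' \<in> carrier_vec n" and Kb: "K *\<^sub>v b' \<in> carrier_vec n" using K a' b' by auto
  \<comment> \<open>\<open>p + iq\<close> is \<open>(1 + iK) S x\<close>, split into real and imaginary parts.\<close>
  define p q where "p = a' - K *\<^sub>v b'" and "q = b' + K *\<^sub>v a'"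
  have p: "p \<in> carrier_vec n" and q: "q \<in> carrier_vec n" using a' b' Ka Kb by (auto simp: p_def q_def)
  define t where "t = S *\<^sub>v unit_vec n i"
  have t: "t \<in> carrier_vec n" using Sc by (simp add: t_def)
  have SKS: "(S * K * S) *\<^sub>v y = S *\<^sub>v (K *\<^sub>v (S *\<^sub>v y))" if "y \<in> carrier_vec n" for y
    using assoc_mult_mat_vec[OF SKc Sc that] assoc_mult_mat_vec[OF Sc K(1), of "S *\<^sub>v y"] Sc that by simp
  have SS: "(S * S) *\<^sub>v y = S *\<^sub>v (S *\<^sub>v y)" if "y \<in> carrier_vec n" for y
    using assoc_mult_mat_vec[OF Sc Sc that] .
  define z where "z = complex_mat (S * S) (S * K * S) *\<^sub>v x"
  have z: "z \<in> carrier_vec n"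
    using mult_mat_vec_carrier[OF complex_mat_carrier[OF SSc SKSc] x] by (simp add: z_def)
  have entry: "(S *\<^sub>v y) $ i = t \<bullet> y" if "y \<in> carrier_vec n" for y
    using symmetric_mat_scalar_prod[OF Sc ST unit_vec_carrier that, of i] 
      scalar_prod_left_unit[of "S *\<^sub>v y" n i] i that Sc by (simp add: t_def)
  have "map_vec Re z = S *\<^sub>v p"
    unfolding z_def complex_mat_mult_vec[OF SSc SKSc x] a_def[symmetric] b_def[symmetric]
    using mult_minus_distrib_mat_vec[OF Sc a' Kb] by (simp add: SS[OF a] SKS[OF b] p_def a'_def b'_def)
  hence "Re (z $ i) = t \<bullet> p" using entry[OF p] z i by (metis carrier_vecD index_map_vec(1))
  moreover have "map_vec Im z = S *\<^sub>v q"
    unfolding z_def complex_mat_mult_vec[OF SSc SKSc x] a_def[symmetric] b_def[symmetric]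
    using mult_add_distrib_mat_vec[OF Sc b' Ka] by (simp add: SS[OF b] SKS[OF a] q_def a'_def b'_def)
  hence "Im (z $ i) = t \<bullet> q" using entry[OF q] z i by (metis carrier_vecD index_map_vec(1))
  ultimately have "(cmod (z $ i))\<^sup>2 = (t \<bullet> p)\<^sup>2 + (t \<bullet> q)\<^sup>2" by (simp add: cmod_power2)
  also have "\<dots> \<le> (t \<bullet> t) * (p \<bullet> p) + (t \<bullet> t) * (q \<bullet> q)"
    using scalar_prod_Cauchy_Schwarz[OF t p] scalar_prod_Cauchy_Schwarz[OF t q] by linarith
  also have "\<dots> = (t \<bullet> t) * (p \<bullet> p + q \<bullet> q)" by (simp add: algebra_simps)
  also have "\<dots> \<le> (t \<bullet> t) * ((1 + d\<^sup>2) * (a' \<bullet> a' + b' \<bullet> b'))"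
  proof (rule mult_left_mono)
    have cross: "a' \<bullet> (K *\<^sub>v b') = b' \<bullet> (K *\<^sub>v a')"
      using symmetric_mat_scalar_prod[OF K a' b'] comm_scalar_prod[OF b' Ka] by simp
    have "p \<bullet> p = a' \<bullet> a' - 2 * (a' \<bullet> (K *\<^sub>v b')) + (K *\<^sub>v b') \<bullet> (K *\<^sub>v b')"
      unfolding p_def minus_scalar_prod_distrib[OF a' Kb minus_carrier_vec[OF a' Kb]]
        scalar_prod_minus_distrib[OF a' a' Kb] scalar_prod_minus_distrib[OF Kb a' Kb]
        comm_scalar_prod[OF Kb a'] by simp
    moreover have "q \<bullet> q = b' \<bullet> b' + 2 * (b' \<bullet> (K *\<^sub>v a')) + (K *\<^sub>v a') \<bullet> (K *\<^sub>v a')"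
      unfolding q_def add_scalar_prod_distrib[OF b' Ka add_carrier_vec[OF b' Ka]]
        scalar_prod_add_distrib[OF b' b' Ka] scalar_prod_add_distrib[OF Ka b' Ka]
        comm_scalar_prod[OF Ka b'] by simp
    ultimately show "p \<bullet> p + q \<bullet> q \<le> (1 + d\<^sup>2) * (a' \<bullet> a' + b' \<bullet> b')"
      using bound[OF a'] bound[OF b'] cross by (simp add: algebra_simps)
  qed (rule scalar_prod_self_nonneg)
  also have "t \<bullet> t = (S * S) $$ (i, i)"
  proof -
    have "t \<bullet> t = (S *\<^sub>v t) $ i" using entry[OF t] by simp
    also have "\<dots> = ((S * S) *\<^sub>v unit_vec n i) $ i" by (simp add: SS t_def)
    also have "\<dots> = (S * S) $$ (i, i)" using mult_unit_vec_index[OF SSc i i] .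
    finally show ?thesis .
  qed
  also have "a' \<bullet> a' = a \<bullet> ((S * S) *\<^sub>v a)"
    using symmetric_mat_scalar_prod[OF Sc ST a a'] SS[OF a] by (simp add: a'_def)
  also have "b' \<bullet> b' = b \<bullet> ((S * S) *\<^sub>v b)"
    using symmetric_mat_scalar_prod[OF Sc ST b b'] SS[OF b] by (simp add: b'_def)
  finally show ?thesis by (simp add: z_def a_def b_def)
qed

lemma finite_entries: "finite {cmod (A $$ (i, j)) | i j. i < dim_row A \<and> j < dim_col A}"
proof -
  have "{cmod (A $$ (i, j)) | i j. i < dim_row A \<and> j < dim_col A} =
    (\<lambda>(i, j). cmod (A $$ (i, j))) ` ({..<dim_row A} \<times> {..<dim_col A})" by auto
  thus ?thesis by simp
qed

lemma max_entry_ge: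
  assumes "i < dim_row A" "j < dim_col A"
  shows "cmod (A $$ (i, j)) \<le> max_entry A"
  unfolding max_entry_def using assms by (intro Max_ge finite_entries) auto

lemma max_entry_le:
  assumes "0 < dim_row A" "0 < dim_col A"
    and "\<And>i j. i < dim_row A \<Longrightarrow> j < dim_col A \<Longrightarrow> cmod (A $$ (i, j)) \<le> b"
  shows "max_entry A \<le> b"
  unfolding max_entry_def using assms by (intro Max.boundedI finite_entries) auto

lemma spd_mat_diag_pos:
  assumes M: "spd_mat n M" and i: "i < n"
  shows "M $$ (i, i) > 0"
proof -
  have "0 < unit_vec n i \<bullet> (M *\<^sub>v unit_vec n i)"
    using i by (intro spd_matD(3)[OF M]) auto
  also have "\<dots> = M $$ (i, i)"
    using scalar_prod_left_unit[of "M *\<^sub>v unit_vec n i" n i] spd_matD(1)[OF M] i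
      mult_unit_vec_index[OF spd_matD(1)[OF M] i i] by simp
  finally show ?thesis .
qed

lemma complex_mat_inject:
  assumes "B \<in> carrier_mat n m" "C \<in> carrier_mat n m" "P \<in> carrier_mat n m" "Q \<in> carrier_mat n m"
    and "complex_mat B C = complex_mat P Q"
  shows "B = P" "C = Q"
proof -
  have *: "Complex (B $$ (i, j)) (C $$ (i, j)) = Complex (P $$ (i, j)) (Q $$ (i, j))" if "i < n" "j < m" for i j
    using complex_mat_index[OF assms(1,2) that] complex_mat_index[OF assms(3,4) that] assms(5) by simp
  show "B = P" "C = Q" using * assms(1-4) by (auto intro!: eq_matI)
qed

text \<open>
  Let \<open>W = (1 - i) A\<close> and \<open>M = B + C\<close>. For the vector \<open>x\<close> attached to column \<open>j\<close>, the entries of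
  \<open>W x\<close> vanish where \<open>x\<close> does not, except at the position of \<open>e\<^sub>j\<close>; hence \<open>x\<^sup>* W x\<close> is the
  \<open>j\<close>-th diagonal entry of the Schur complement of \<open>W\<close>. The estimate for
  single entries thus bounds that diagonal entry in terms of itself, and every other
  entry of column \<open>j\<close> in terms of the diagonal one.
\<close>
lemma active_mat_entry_bound:
  assumes B: "spd_mat n B" and C: "spd_mat n C" and k: "k < n" and ij: "i < n - k" "j < n - k"
  shows "cmod (active_mat (complex_mat B C) k $$ (i, j)) \<le>
    (1 + (higham_delta B C)\<^sup>2) * max_entry (complex_mat B C)"
    and "active_mat (complex_mat B C) k \<in> carrier_mat (n - k) (n - k)"
proof -
  note Bc = spd_matD(1)[OF B] and Cc = spd_matD(1)[OF C]
  let ?A = "complex_mat B C" and ?M = "B + C" and ?D = "C - B"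
  let ?W = "complex_mat ?M ?D"
  define \<alpha> where "\<alpha> = 1 + (higham_delta B C)\<^sup>2"
  have \<alpha>: "\<alpha> > 0" unfolding \<alpha>_def by (simp add: add_pos_nonneg)
  have A: "?A \<in> carrier_mat n n" using Bc Cc by simp
  have M: "spd_mat n ?M" by (rule spd_mat_add[OF B C])
  note Mc = spd_matD(1)[OF M]
  have D: "?D \<in> carrier_mat n n" "transpose_mat ?D = ?D"
    using Bc Cc transpose_minus[OF Cc Bc] spd_matD(2)[OF B] spd_matD(2)[OF C] by auto
  obtain S K where S: "spd_mat n S" "S * S = ?M" and K: "K \<in> carrier_mat n n" "transpose_mat K = K" "S * K * S = ?D"
    and bound: "\<And>y. y \<in> carrier_vec n \<Longrightarrow> (K *\<^sub>v y) \<bullet> (K *\<^sub>v y) \<le> (higham_delta B C)\<^sup>2 * (y \<bullet> y)"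
    using higham_delta_factorization[OF B C] k by (metis gr_implies_not_zero neq0_conv)
  have inj: "\<forall>x \<in> carrier_vec n. (\<forall>l. k \<le> l \<longrightarrow> l < n \<longrightarrow> x $ l = 0) \<longrightarrow>
    (\<forall>l<k. (?A *\<^sub>v x) $ l = 0) \<longrightarrow> x = 0\<^sub>v n"
    using higham_leading_block_inj[OF B C] by blast
  note act = active_mat_as_image[OF A less_imp_le[OF k] inj]
  show "active_mat ?A k \<in> carrier_mat (n - k) (n - k)" by (rule act(1))
  from act(2)[OF ij(2)] obtain x where x: "x \<in> carrier_vec n" "x $ (k + j) = 1"
    "\<forall>l<n. k \<le> l \<longrightarrow> l \<noteq> k + j \<longrightarrow> x $ l = 0" "\<forall>l<k. (?A *\<^sub>v x) $ l = 0"
    "\<forall>i<n - k. (?A *\<^sub>v x) $ (k + i) = active_mat ?A k $$ (i, j)" by blast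
  have kij: "k + i < n" "k + j < n" using ij by auto
  define z where "z = ?W *\<^sub>v x"
  have z: "z \<in> carrier_vec n"
    using mult_mat_vec_carrier[OF complex_mat_carrier[OF Mc D(1)] x(1)] by (simp add: z_def)
  have zA: "z $ l = (1 - \<i>) * (?A *\<^sub>v x) $ l" if "l < n" for l
    unfolding z_def by (rule complex_mat_rotate[OF Bc Cc x(1) that])
  let ?E = "map_vec Re x \<bullet> (?M *\<^sub>v map_vec Re x) + map_vec Im x \<bullet> (?M *\<^sub>v map_vec Im x)"
  have E: "?E = Re (z $ (k + j))"
  proof -
    have "?E = map_vec Re x \<bullet> map_vec Re z + map_vec Im x \<bullet> map_vec Im z"
      using complex_mat_energy[OF Mc D x(1)] by (simp add: z_def)
    also have "\<dots> = (\<Sum>l<n. Re (cnj (x $ l) * z $ l))"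
      using x(1) z by (simp add: scalar_prod_def atLeast0LessThan sum.distrib)
    also have "\<dots> = (\<Sum>l<n. if l = k + j then Re (z $ (k + j)) else 0)"
    proof (rule sum.cong)
      fix l assume "l \<in> {..<n}"
      thus "Re (cnj (x $ l) * z $ l) = (if l = k + j then Re (z $ (k + j)) else 0)"
        using x(2) x(3)[rule_format, of l] x(4)[rule_format, of l] zA[of l] by (cases "l < k") auto
    qed simp
    also have "\<dots> = Re (z $ (k + j))" using kij by simp
    finally show ?thesis .
  qed
  have entry: "(cmod (z $ l))\<^sup>2 \<le> ?M $$ (l, l) * (\<alpha> * cmod (z $ (k + j)))" if l: "l < n" for l
  proof -
    have "(cmod (z $ l))\<^sup>2 \<le> ?M $$ (l, l) * (\<alpha> * ?E)"
      using accretive_entry_bound[OF S(1) K(1,2) bound x(1) l] by (simp add: S(2) K(3) z_def \<alpha>_def)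
    also have "\<dots> \<le> ?M $$ (l, l) * (\<alpha> * cmod (z $ (k + j)))"
      unfolding E using spd_mat_diag_pos[OF M l] \<alpha> complex_Re_le_cmod
      by (intro mult_left_mono) auto
    finally show ?thesis .
  qed
  define \<mu> where "\<mu> = sqrt 2 * max_entry ?A"
  \<comment> \<open>The factor \<open>sqrt 2\<close> from \<open>b + c \<le> sqrt 2 * |b + ic|\<close> is the one that passing from
    \<open>A\<close> to \<open>(1 - i) A\<close> introduces, so the two cancel in the end.\<close>
  have M\<mu>: "?M $$ (l, l) \<le> \<mu>" if l: "l < n" for l
  proof -
    have "?M $$ (l, l) \<le> sqrt 2 * cmod (?A $$ (l, l))"
    proof (rule power2_le_imp_le)
      have "(?M $$ (l, l))\<^sup>2 \<le> 2 * ((B $$ (l, l))\<^sup>2 + (C $$ (l, l))\<^sup>2)"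
        using l Bc Cc sum_squares_bound[of "B $$ (l, l)" "C $$ (l, l)"]
        by (simp add: power2_eq_square algebra_simps)
      thus "(?M $$ (l, l))\<^sup>2 \<le> (sqrt 2 * cmod (?A $$ (l, l)))\<^sup>2"
        by (simp add: complex_mat_index[OF Bc Cc l l] cmod_power2 power_mult_distrib)
    qed simp
    also have "\<dots> \<le> \<mu>" unfolding \<mu>_def using max_entry_ge[of l ?A l] A l by simp
    finally show ?thesis .
  qed
  have \<mu>: "\<mu> > 0" using M\<mu>[OF kij(1)] spd_mat_diag_pos[OF M kij(1)] by linarith
  have diag: "cmod (z $ (k + j)) \<le> \<mu> * \<alpha>"
  proof (cases "z $ (k + j) = 0")
    case True
    thus ?thesis using \<mu> \<alpha> by simp
  next
    case False
    have "cmod (z $ (k + j)) * cmod (z $ (k + j)) \<le> (?M $$ (k + j, k + j) * \<alpha>) * cmod (z $ (k + j))"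
      using entry[OF kij(2)] by (simp add: power2_eq_square mult.assoc)
    hence "cmod (z $ (k + j)) \<le> ?M $$ (k + j, k + j) * \<alpha>" using False by simp
    also have "\<dots> \<le> \<mu> * \<alpha>" using M\<mu>[OF kij(2)] \<alpha> by simp
    finally show ?thesis .
  qed
  have "cmod (z $ (k + i)) \<le> \<mu> * \<alpha>"
  proof (rule power2_le_imp_le)
    have "(cmod (z $ (k + i)))\<^sup>2 \<le> \<mu> * (\<alpha> * (\<mu> * \<alpha>))"
      using entry[OF kij(1)] M\<mu>[OF kij(1)] diag spd_mat_diag_pos[OF M kij(1)] \<alpha> \<mu>
      by (meson mult_mono order_trans mult_left_mono less_imp_le mult_nonneg_nonneg norm_ge_zero)
    thus "(cmod (z $ (k + i)))\<^sup>2 \<le> (\<mu> * \<alpha>)\<^sup>2" by (simp add: power2_eq_square algebra_simps)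
  qed (use \<mu> \<alpha> in simp)
  moreover have "cmod (1 - \<i>) = sqrt 2" by (simp add: cmod_def)
  moreover have "z $ (k + i) = (1 - \<i>) * active_mat ?A k $$ (i, j)"
    using zA[OF kij(1)] x(5) ij(1) by simp
  ultimately have "sqrt 2 * cmod (active_mat ?A k $$ (i, j)) \<le> \<mu> * \<alpha>"
    by (simp add: norm_mult)
  also have "\<dots> = sqrt 2 * (\<alpha> * max_entry ?A)" by (simp add: \<mu>_def)
  finally have "cmod (active_mat ?A k $$ (i, j)) \<le> \<alpha> * max_entry ?A" by simp
  thus "cmod (active_mat ?A k $$ (i, j)) \<le> (1 + (higham_delta B C)\<^sup>2) * max_entry ?A"
    by (simp add: \<alpha>_def)
qed

theorem mainTheorem4:
  fixes n :: nat and A :: "complex mat" and B C :: "real mat"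
  assumes "n \<ge> 2"
    and "B \<in> carrier_mat n n"
    and "C \<in> carrier_mat n n"
    and "A = complex_mat B C"
    and "A \<in> higham_mats n"
  shows "growth_factor A \<le> 1 + (higham_delta B C)\<^sup>2 \<and> 1 + (higham_delta B C)\<^sup>2 < 2"
proof
  obtain P Q where PQ: "A = complex_mat P Q" "spd_mat n P" "spd_mat n Q"
    using assms(5) by (auto simp: higham_mats_def)
  have "B = P" "C = Q"
    using complex_mat_inject[OF assms(2,3) spd_matD(1)[OF PQ(2)] spd_matD(1)[OF PQ(3)]] PQ(1) assms(4)
    by auto
  hence B: "spd_mat n B" and C: "spd_mat n C" using PQ by auto
  obtain "0 \<le> higham_delta B C" "higham_delta B C < 1"
    using higham_delta_factorization[OF B C] assms(1) by (metis gr0I not_numeral_le_zero)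
  thus "1 + (higham_delta B C)\<^sup>2 < 2" by (simp add: power_less_one_iff abs_square_less_1)
  have dim: "A \<in> carrier_mat n n" using assms by simp
  have "0 < Re (A $$ (0, 0))"
    using spd_mat_diag_pos[OF B, of 0] assms(1) complex_mat_index[OF assms(2,3), of 0 0] assms(4) by simp
  also have "\<dots> \<le> max_entry A"
    using max_entry_ge[of 0 A 0] dim assms(1) complex_Re_le_cmod order_trans by fastforce
  finally have pos: "max_entry A > 0" .
  have "max_entry (active_mat A k) \<le> (1 + (higham_delta B C)\<^sup>2) * max_entry A" if "k \<in> {1..n - 1}" for k
  proof -
    have k: "k < n" "0 < n - k" using that assms(1) by auto
    have "active_mat A k \<in> carrier_mat (n - k) (n - k)"
      unfolding assms(4) by (rule active_mat_entry_bound(2)[OF B C k(1) k(2) k(2)])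
    thus ?thesis
      using k active_mat_entry_bound(1)[OF B C k(1)] unfolding assms(4) by (intro max_entry_le) auto
  qed
  hence "Max ((\<lambda>k. max_entry (active_mat A k)) ` {1..dim_row A - 1}) \<le> (1 + (higham_delta B C)\<^sup>2) * max_entry A"
    using dim assms(1) by (intro Max.boundedI) auto
  thus "growth_factor A \<le> 1 + (higham_delta B C)\<^sup>2"
    unfolding growth_factor_def using pos by (simp add: divide_le_eq)
qed

end
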